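(* For every integer $\ell\geq 2$, there is a family of $\ell$ pairwise non-cospectral unicyclic graphs, each with $n=2\ell^2+2\ell+2$ vertices, all having the same Laplacian energy. In particular, for values of $n$ of this form, there is a family of $\Theta(\sqrt{n})$ pairwise non-cospectral unicyclic graphs on $n$ vertices with the same Laplacian energy.
   Context: A unicyclic graph is a connected graph containing exactly one cycle. Cospectrality refers to the Laplacian spectrum (multiset of eigenvalues of $L=D-A$, with $D$ the diagonal degree matrix and $A$ the adjacency matrix). For a graph on $n$ vertices with Laplacian eigenvalues $\mu_1,\ldots,\mu_n$ and average degree $\overline{d}$, the Laplacian energy is $LE(G)=\sum_{i=1}^n|\mu_i-\overline{d}|$. *)

theory Defs
  imports
    "Graph_Theory.Graph_Theory"
    "Jordan_Normal_Form.Char_Poly"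
    "HOL-Library.Landau_Symbols"
begin

text \<open>
  A finite simple graph is a \<^locale>\<open>pair_graph\<close>: a finite loop-free symmetric digraph whose arcs are
  pairs of vertices. Each edge is present as two opposite arcs, so the degree of a vertex is its
  out-degree. For the matrices, the vertices of a graph on $n$ vertices are labelled
  $0,\dots,n-1$.
\<close>

definition graph_on :: "nat \<Rightarrow> nat pair_pre_digraph \<Rightarrow> bool" where
  "graph_on n G \<longleftrightarrow> pair_graph G \<and> pverts G = {0..<n}"

text \<open>
  In a symmetric digraph, going back and forth along one edge is a cycle of length 2 in the sense of
  \<^const>\<open>pre_digraph.cycle\<close>; requiring length at least 3 leaves exactly the cycles of the undirected
  graph. A cycle is identified with its set of undirected edges, so that the choice of starting
  point and orientation does not count.
\<close>

definition cycle_edge_sets :: "'a pair_pre_digraph \<Rightarrow> 'a set set set" where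
  "cycle_edge_sets G =
     {(\<lambda>(u, v). {u, v}) ` set p | p. pre_digraph.cycle (with_proj G) p \<and> 3 \<le> length p}"

definition unicyclic :: "'a pair_pre_digraph \<Rightarrow> bool" where
  "unicyclic G \<longleftrightarrow> Digraph_Component.connected (with_proj G) \<and> (\<exists>!C. C \<in> cycle_edge_sets G)"

abbreviation num_verts :: "'a pair_pre_digraph \<Rightarrow> nat" where
  "num_verts G \<equiv> card (pverts G)"

abbreviation degree_of :: "'a pair_pre_digraph \<Rightarrow> 'a \<Rightarrow> nat" where
  "degree_of G v \<equiv> out_degree (with_proj G) v"

definition adjacency_matrix :: "nat pair_pre_digraph \<Rightarrow> real mat" where
  "adjacency_matrix G =
     mat (num_verts G) (num_verts G) (\<lambda>(i, j). if (i, j) \<in> parcs G then 1 else 0)"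

definition degree_matrix :: "nat pair_pre_digraph \<Rightarrow> real mat" where
  "degree_matrix G =
     mat (num_verts G) (num_verts G) (\<lambda>(i, j). if i = j then real (degree_of G i) else 0)"

definition laplacian_matrix :: "nat pair_pre_digraph \<Rightarrow> real mat" where
  "laplacian_matrix G = degree_matrix G - adjacency_matrix G"

text \<open>
  The eigenvalues with their algebraic multiplicities. The Laplacian matrix is real symmetric, so
  taking real roots loses nothing: see \<open>size_laplacian_spectrum\<close> below.
\<close>

definition laplacian_spectrum :: "nat pair_pre_digraph \<Rightarrow> real multiset" where
  "laplacian_spectrum G = proots (char_poly (laplacian_matrix G))"

definition cospectral :: "nat pair_pre_digraph \<Rightarrow> nat pair_pre_digraph \<Rightarrow> bool" where
  "cospectral G H \<longleftrightarrow> laplacian_spectrum G = laplacian_spectrum H"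

definition average_degree :: "'a pair_pre_digraph \<Rightarrow> real" where
  "average_degree G = (\<Sum>v\<in>pverts G. real (degree_of G v)) / real (num_verts G)"

definition laplacian_energy :: "nat pair_pre_digraph \<Rightarrow> real" where
  "laplacian_energy G = (\<Sum>\<mu>\<in>#laplacian_spectrum G. \<bar>\<mu> - average_degree G\<bar>)"

definition noncospectral_equienergetic_family :: "nat \<Rightarrow> nat pair_pre_digraph set \<Rightarrow> bool" where
  "noncospectral_equienergetic_family n \<F> \<longleftrightarrow>
     finite \<F> \<and>
     (\<forall>G\<in>\<F>. graph_on n G \<and> unicyclic G) \<and>
     (\<forall>G\<in>\<F>. \<forall>H\<in>\<F>. G \<noteq> H \<longrightarrow> \<not> cospectral G H) \<and>
     (\<forall>G\<in>\<F>. \<forall>H\<in>\<F>. laplacian_energy G = laplacian_energy H)"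

lemma symmetric_eigenvalue_real:
  fixes A :: "real mat"
  assumes A: "A \<in> carrier_mat n n"
    and sym: "\<And>i j. i < n \<Longrightarrow> j < n \<Longrightarrow> A $$ (i, j) = A $$ (j, i)"
    and ev: "eigenvalue (map_mat complex_of_real A) a"
  shows "a \<in> \<real>"
proof -
  obtain v where v: "v \<in> carrier_vec n" "v \<noteq> 0\<^sub>v n"
    and eq: "map_mat complex_of_real A *\<^sub>v v = a \<cdot>\<^sub>v v"
    using ev A unfolding eigenvalue_def eigenvector_def by auto
  have row: "(\<Sum>j<n. of_real (A $$ (i, j)) * v $ j) = a * v $ i" if i: "i < n" for i
  proof -
    have "(map_mat complex_of_real A *\<^sub>v v) $ i = (\<Sum>j<n. of_real (A $$ (i, j)) * v $ j)"
      using i A v by (simp add: scalar_prod_def lessThan_atLeast0)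
    then show ?thesis using eq i v by simp
  qed
  define S where "S = (\<Sum>i<n. \<Sum>j<n. cnj (v $ i) * (of_real (A $$ (i, j)) * v $ j))"
  define N where "N = (\<Sum>i<n. (cmod (v $ i))\<^sup>2)"
  have "S = (\<Sum>i<n. cnj (v $ i) * (a * v $ i))"
    unfolding S_def by (intro sum.cong refl) (simp add: row flip: sum_distrib_left)
  also have "\<dots> = a * of_real N"
    unfolding N_def of_real_sum sum_distrib_left
    by (intro sum.cong refl) (simp add: complex_norm_square mult_ac flip: of_real_power)
  finally have SN: "S = a * of_real N" .
  have "cnj S = (\<Sum>i<n. \<Sum>j<n. cnj (v $ j) * (of_real (A $$ (j, i)) * v $ i))"
    unfolding S_def cnj_sum by (intro sum.cong refl) (auto simp: sym mult_ac)
  also have "\<dots> = S"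
    unfolding S_def by (rule sum.swap)
  finally have "cnj a * of_real N = a * of_real N"
    using SN by simp
  moreover have "N \<noteq> 0"
  proof
    assume "N = 0"
    then have "\<forall>i<n. v $ i = 0"
      unfolding N_def by (subst (asm) sum_nonneg_eq_0_iff) auto
    with v show False by auto
  qed
  ultimately show ?thesis by (simp add: Reals_cnj_iff)
qed

lemma size_proots_char_poly_symmetric:
  fixes A :: "real mat"
  assumes A: "A \<in> carrier_mat n n"
    and sym: "\<And>i j. i < n \<Longrightarrow> j < n \<Longrightarrow> A $$ (i, j) = A $$ (j, i)"
  shows "size (proots (char_poly A)) = n"
proof -
  interpret poly_hom: map_poly_inj_idom_hom complex_of_real ..
  let ?C = "map_mat complex_of_real A"
  have C: "?C \<in> carrier_mat n n" using A by simp
  obtain as where as: "char_poly ?C = (\<Prod>a\<leftarrow>as. [:- a, 1:])" "length as = n"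
    using char_poly_factorized[OF C] by auto
  have real: "complex_of_real (Re a) = a" if "a \<in> set as" for a
  proof -
    have "poly (char_poly ?C) a = 0"
      using that unfolding as(1) by (induction as) auto
    then have "eigenvalue ?C a" using eigenvalue_root_char_poly[OF C] by simp
    then show ?thesis using symmetric_eigenvalue_real[OF A sym] by (simp add: of_real_Re)
  qed
  have "map_poly complex_of_real (char_poly A) = (\<Prod>a\<leftarrow>as. [:- a, 1:])"
    using as(1) by (simp add: of_real_hom.char_poly_hom[OF A])
  also have "\<dots> = map_poly complex_of_real (\<Prod>a\<leftarrow>as. [:- Re a, 1:])"
    using real by (induction as) (auto simp: poly_hom.hom_mult simp del: mult_pCons_left)
  finally have "char_poly A = (\<Prod>a\<leftarrow>as. [:- Re a, 1:])"
    by (simp only: poly_hom.eq_iff)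
  moreover have "proots (\<Prod>a\<leftarrow>xs. [:- Re a, 1:]) = mset (map Re xs) \<and> (\<Prod>a\<leftarrow>xs. [:- Re a, 1:]) \<noteq> 0" for xs
    by (induction xs) (auto simp: proots_mult simp del: mult_pCons_left)
  ultimately show ?thesis using as(2) by simp
qed

lemma size_laplacian_spectrum:
  assumes "graph_on n G"
  shows "size (laplacian_spectrum G) = n"
proof -
  interpret pair_graph G using assms by (simp add: graph_on_def)
  have "(i, j) \<in> parcs G \<longleftrightarrow> (j, i) \<in> parcs G" for i j
    using pair_sym_arcs by (auto simp: symmetric_def dest: symD)
  then show ?thesis
    using assms unfolding laplacian_spectrum_def graph_on_def
    by (intro size_proots_char_poly_symmetric)
       (auto simp: laplacian_matrix_def degree_matrix_def adjacency_matrix_def)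
qed

end

theory Submission
  imports Defs
begin

text \<open>
  A unicyclic graph has average degree 2, so its Laplacian energy is the trace norm of $L - 2$ and
  depends only on the spectrum of $(L - 2)^2$. Let $T$ be a tree with two pendant paths of length $m$
  hanging from the same vertex, let $P$ be the permutation matrix of the automorphism of $T$ that swaps
  them, and put $M = L(T) - 2$. Then $M$ and $P$ commute, hence $(M P)^2 = M^2$. On the other hand, $M$ has
  diagonal entry 0 at the inner vertices of the paths and $-1$ at their ends, so that $M P + 2$ is up to
  relabelling the Laplacian of the unicyclic graph obtained from $T$ by joining the two ends. A spider
  with pairs of legs of lengths $1, \dots, \ell$ therefore yields $\ell$ unicyclic graphs of equal energy.

  They are told apart by $\det (L + J)$, with $J$ the all-ones matrix. The spectrum determines this number
  because $L J = 0$, and adding the edge multiplies it by $1 + 2m$, one plus the effective resistance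
  between the two ends.
\<close>

section \<open>A tree plus an edge is unicyclic\<close>

text \<open>A cycle enters and leaves each of its vertices exactly once, so \<open>v\<close> lies on
  no edge or on two; length at least 3 keeps these two apart. This parity is the only property of
  cycles used for uniqueness.\<close>

lemma cycle_incident_even:
  assumes "pre_digraph.cycle (with_proj G) p" and len: "3 \<le> length p"
  shows "even (card {e \<in> (\<lambda>(u, v). {u, v}) ` set p. v \<in> e})"
proof -
  interpret pair_pre_digraph G .
  obtain u where cas: "pcas u p u" and dist: "distinct (tl (pawalk_verts u p))"
    using assms(1) by (auto simp: cycle_def awalk_def)
  \<comment> \<open>The definition of a cycle makes the tail of the vertex list distinct, that is,
    the heads of the arcs. Distinct tails follow below by shifting indices cyclically.\<close>
  have heads: "tl (pawalk_verts x p) = map snd p" if "pcas x p y" for x y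
    using that
  proof (induction p arbitrary: x)
    case (Cons a p)
    then show ?case by (cases p) auto
  qed simp
  define k where "k = length p"
  have step: "pcas x p y \<Longrightarrow> Suc i < length p \<Longrightarrow> snd (p ! i) = fst (p ! Suc i)" for x y i
  proof (induction p arbitrary: x i)
    case (Cons a p)
    then show ?case by (cases i; cases p) auto
  qed simp
  have ends: "pcas x p y \<Longrightarrow> p \<noteq> [] \<Longrightarrow> fst (hd p) = x \<and> snd (last p) = y" for x y
    by (induction p arbitrary: x) auto
  have k: "3 \<le> k" using len by (simp add: k_def)
  have cyc: "snd (p ! i) = fst (p ! (Suc i mod k))" if "i < k" for i
  proof (cases "Suc i = k")
    case True
    have "p \<noteq> []" using len by auto
    moreover have "i = length p - 1" using True by (simp add: k_def)
    ultimately have "p ! i = last p" "p ! 0 = hd p"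
      by (simp_all add: last_conv_nth hd_conv_nth)
    then show ?thesis using ends[OF cas \<open>p \<noteq> []\<close>] True by simp
  next
    case False
    then show ?thesis using that step[OF cas, of i] by (simp add: k_def)
  qed
  have head_inj: "i = j" if "i < k" "j < k" "snd (p ! i) = snd (p ! j)" for i j
    using dist that heads[OF cas] by (simp add: k_def distinct_conv_nth) metis
  have pred: "\<exists>j<k. i = Suc j mod k" if "i < k" for i
    using that by (cases i) (auto intro: exI[of _ "k - 1"] exI[of _ "i - 1"])
  have succ_inj: "i = j" if "i < k" "j < k" "Suc i mod k = Suc j mod k" for i j
    using that by (simp add: mod_Suc split: if_splits)
  have tail_inj: "i = j" if "i < k" "j < k" "fst (p ! i) = fst (p ! j)" for i j
    using that cyc head_inj pred by metis
  let ?C = "{e \<in> (\<lambda>(u, v). {u, v}) ` set p. v \<in> e}"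
  show ?thesis
  proof (cases "\<exists>i<k. snd (p ! i) = v")
    case False
    have "fst (p ! i) \<noteq> v" if "i < k" for i
      using False pred[OF that] cyc by metis
    with False have "?C = {}"
      by (auto simp: in_set_conv_nth k_def) (metis fst_conv snd_conv)+
    then show ?thesis by (metis card.empty even_zero)
  next
    case True
    then obtain i where i: "i < k" "snd (p ! i) = v" by blast
    define j where "j = Suc i mod k"
    have j: "j < k" "fst (p ! j) = v" using cyc[OF i(1)] i k by (auto simp: j_def)
    define l where "l = Suc j mod k"
    \<comment> \<open>If the predecessor and the successor of \<open>v\<close> coincide, then
      \<open>i\<close> is congruent to \<open>i + 2\<close> modulo \<open>k\<close>, which
      \<open>k \<ge> 3\<close> excludes.\<close>
    have "fst (p ! i) \<noteq> snd (p ! j)"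
    proof
      assume "fst (p ! i) = snd (p ! j)"
      then have "i = l"
        using cyc[OF j(1)] tail_inj[of i l] i k by (simp add: l_def)
      then show False
        using i(1) k by (simp add: l_def j_def mod_Suc split: if_splits)
    qed
    then have ne: "{fst (p ! i), v} \<noteq> {v, snd (p ! j)}" by (auto simp: doubleton_eq_iff)
    have "?C = {{fst (p ! i), v}, {v, snd (p ! j)}}"
    proof (intro equalityI subsetI)
      fix e assume "e \<in> ?C"
      then obtain m where m: "m < k" "e = {fst (p ! m), snd (p ! m)}" "v \<in> e"
        by (auto simp: in_set_conv_nth k_def)
      then show "e \<in> {{fst (p ! i), v}, {v, snd (p ! j)}}"
      proof (cases "fst (p ! m) = v")
        case True
        then have "m = j" using tail_inj[OF m(1) j(1)] j(2) by simp
        then show ?thesis using m(2) True by simp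
      next
        case False
        then have "snd (p ! m) = v" using m by auto
        moreover from this have "m = i" using head_inj[OF m(1) i(1)] i(2) by simp
        ultimately show ?thesis using m(2) by simp
      qed
    next
      fix e assume "e \<in> {{fst (p ! i), v}, {v, snd (p ! j)}}"
      moreover have "p ! i \<in> set p" "p ! j \<in> set p" using i j by (auto simp: k_def)
      ultimately show "e \<in> ?C"
        using i(2) j(2) by (auto simp: image_iff split_beta insert_commute intro: bexI[of _ "p ! i"] bexI[of _ "p ! j"])
    qed
    then have "card ?C = 2" using ne by simp
    then show ?thesis by presburger
  qed
qed

lemma even_card_sym_diff:
  assumes "finite A" "finite B" "even (card A)" "even (card B)"
  shows "even (card (A - B \<union> (B - A)))"
proof -
  have "card (A - B \<union> (B - A)) = card (A - B) + card (B - A)"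
    using assms by (intro card_Un_disjoint) auto
  moreover have "card A = card (A - B) + card (A \<inter> B)" "card B = card (B - A) + card (A \<inter> B)"
    using assms by (subst card_Un_disjoint[symmetric]; auto intro: arg_cong[of _ _ card])+
  ultimately show ?thesis using assms(3,4) by presburger
qed

section \<open>Rooted trees given by a parent function, with one extra edge\<close>

definition parent_adj :: "(nat \<Rightarrow> nat) \<Rightarrow> nat \<Rightarrow> nat \<Rightarrow> bool" where
  "parent_adj par u v \<longleftrightarrow> 0 < v \<and> u = par v \<or> 0 < u \<and> v = par u"

definition parent_tree_plus :: "(nat \<Rightarrow> nat) \<Rightarrow> nat \<Rightarrow> nat \<Rightarrow> nat \<Rightarrow> nat pair_pre_digraph" where
  "parent_tree_plus par n p q =
     \<lparr>pverts = {0..<n},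
      parcs = {(u, v). u < n \<and> v < n \<and> (parent_adj par u v \<or> u = p \<and> v = q \<or> u = q \<and> v = p)}\<rparr>"

text \<open>Since parents have smaller labels, the labels below \<open>n\<close> form a tree with
  root 0; the value \<open>par 0\<close> is never read. The assumption \<open>not_adj\<close> makes
  the edge between \<open>p\<close> and \<open>q\<close> a new one.\<close>

locale parent_tree_edge =
  fixes par :: "nat \<Rightarrow> nat" and n p q :: nat
  assumes par_less: "\<And>v. 0 < v \<Longrightarrow> par v < v"
    and p_less: "p < n" and q_less: "q < n"
    and p_neq_q: "p \<noteq> q"
    and not_adj: "\<not> parent_adj par p q"
begin

abbreviation "G \<equiv> parent_tree_plus par n p q"

lemma parent_adj_sym: "parent_adj par u v \<longleftrightarrow> parent_adj par v u"
  by (auto simp: parent_adj_def)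

lemma parent_adj_irrefl: "\<not> parent_adj par u u"
  using par_less[of u] by (auto simp: parent_adj_def)

lemma graph_on_parent_tree_plus: "graph_on n G"
proof -
  have "finite (parcs G)"
    by (rule finite_subset[of _ "{0..<n} \<times> {0..<n}"]) (auto simp: parent_tree_plus_def)
  moreover have "symmetric (with_proj G)"
    by (auto simp: symmetric_def parent_tree_plus_def parent_adj_sym intro!: symI)
  ultimately have "pair_graph G"
    using p_neq_q parent_adj_irrefl
    by unfold_locales (auto simp: parent_tree_plus_def)
  then show ?thesis by (simp add: graph_on_def parent_tree_plus_def)
qed

text \<open>The largest vertex that is joined to its parent within \<^term>\<open>S\<close> lies on a single edge of \<^term>\<open>S\<close>.\<close>

lemma even_tree_edges_empty:
  assumes sub: "S \<subseteq> {{v, par v} | v. 0 < v \<and> v < n}"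
    and even: "\<And>v. even (card {e \<in> S. v \<in> e})"
  shows "S = {}"
proof (rule ccontr)
  assume "S \<noteq> {}"
  define V where "V = {v. 0 < v \<and> v < n \<and> {v, par v} \<in> S}"
  have "finite V" "V \<noteq> {}" using \<open>S \<noteq> {}\<close> sub by (auto simp: V_def)
  define v where "v = Max V"
  have v: "v \<in> V" "\<And>w. w \<in> V \<Longrightarrow> w \<le> v"
    using \<open>finite V\<close> \<open>V \<noteq> {}\<close> by (auto simp: v_def)
  have "{e \<in> S. v \<in> e} = {{v, par v}}"
  proof (intro equalityI subsetI)
    fix e assume "e \<in> {e \<in> S. v \<in> e}"
    then obtain w where w: "w \<in> V" "e = {w, par w}" "v \<in> e"
      using sub by (auto simp: V_def)
    have "w = v" using v(2)[OF w(1)] par_less[of w] w by (auto simp: V_def)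
    then show "e \<in> {{v, par v}}" using w by simp
  qed (use v in \<open>auto simp: V_def\<close>)
  then show False using even[of v] by simp
qed

lemma cycle_edges_subset:
  assumes "C \<in> cycle_edge_sets G"
  shows "C \<subseteq> insert {p, q} {{v, par v} | v. 0 < v \<and> v < n}"
proof -
  obtain c where c: "pre_digraph.cycle (with_proj G) c" "C = (\<lambda>(u, v). {u, v}) ` set c"
    using assms by (auto simp: cycle_edge_sets_def)
  interpret pair_pre_digraph G .
  have "set c \<subseteq> parcs G" using c(1) by (auto simp: cycle_def awalk_def)
  then show ?thesis
    unfolding c(2) by (fastforce simp: parent_tree_plus_def parent_adj_def insert_commute)
qed

lemma cycle_edges_even:
  "C \<in> cycle_edge_sets G \<Longrightarrow> even (card {e \<in> C. v \<in> e})"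
  by (auto simp: cycle_edge_sets_def intro: cycle_incident_even)

text \<open>Without the extra edge, the cycle would be a nonempty even set of tree edges.\<close>

lemma cycle_edges_contain:
  assumes C: "C \<in> cycle_edge_sets G"
  shows "{p, q} \<in> C"
proof (rule ccontr)
  assume "{p, q} \<notin> C"
  then have "C = {}"
    using cycle_edges_subset[OF C] cycle_edges_even[OF C] by (intro even_tree_edges_empty) auto
  then show False using C by (auto simp: cycle_edge_sets_def)
qed

text \<open>The extra edge cancels in the symmetric difference of two cycles, which is thus an even
  set of tree edges and hence empty.\<close>

lemma cycle_edges_unique:
  assumes C: "C \<in> cycle_edge_sets G" and D: "D \<in> cycle_edge_sets G"
  shows "C = D"
proof -
  have "finite C" "finite D" using C D by (auto simp: cycle_edge_sets_def)
  let ?S = "C - D \<union> (D - C)"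
  have "?S = {}"
  proof (rule even_tree_edges_empty)
    show "?S \<subseteq> {{v, par v} | v. 0 < v \<and> v < n}"
      using cycle_edges_subset[OF C] cycle_edges_subset[OF D]
        cycle_edges_contain[OF C] cycle_edges_contain[OF D] by blast
    fix v
    have "{e \<in> ?S. v \<in> e} = ({e \<in> C. v \<in> e} - {e \<in> D. v \<in> e}) \<union> ({e \<in> D. v \<in> e} - {e \<in> C. v \<in> e})"
      by auto
    then show "even (card {e \<in> ?S. v \<in> e})"
      using even_card_sym_diff[OF _ _ cycle_edges_even[OF C] cycle_edges_even[OF D]]
        \<open>finite C\<close> \<open>finite D\<close> by simp
  qed
  then show ?thesis by auto
qed

text \<open>The bare tree: it supplies connectedness and the path from \<open>p\<close> to
  \<open>q\<close> that the extra edge closes.\<close>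

definition "T = \<lparr>pverts = {0..<n}, parcs = {(u, v). u < n \<and> v < n \<and> parent_adj par u v}\<rparr>"

lemma pverts_T: "pverts T = {0..<n}"
  by (simp add: T_def)

lemma pair_graph_T: "pair_graph T"
proof -
  have "finite (parcs T)"
    by (rule finite_subset[of _ "{0..<n} \<times> {0..<n}"]) (auto simp: T_def)
  moreover have "symmetric (with_proj T)"
    by (auto simp: symmetric_def T_def parent_adj_sym intro!: symI)
  ultimately show ?thesis
    using parent_adj_irrefl by unfold_locales (auto simp: T_def)
qed

lemma reachable_T:
  assumes "u < n" "v < n"
  shows "u \<rightarrow>\<^sup>*\<^bsub>with_proj T\<^esub> v"
proof -
  interpret T: pair_graph T by (rule pair_graph_T)
  have "0 \<rightarrow>\<^sup>*\<^bsub>with_proj T\<^esub> v" if "v < n" for v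
    using that
  proof (induction v rule: less_induct)
    case (less v)
    show ?case
    proof (cases "v = 0")
      case True
      then show ?thesis using T.reachable_refl[of 0] less.prems by (simp add: pverts_T)
    next
      case False
      then have "par v < v" using par_less by simp
      then have "0 \<rightarrow>\<^sup>*\<^bsub>with_proj T\<^esub> par v" using less by simp
      moreover have "(par v, v) \<in> parcs T"
        using False \<open>par v < v\<close> less.prems by (simp add: T_def parent_adj_def)
      ultimately show ?thesis using T.reachable_adj_trans by (metis with_proj_simps(3))
    qed
  qed
  then show ?thesis using assms symmetric_reachable[OF T.sym_arcs] T.reachable_trans by blast
qed

lemma connected_parent_tree_plus: "Digraph_Component.connected (with_proj G)"
proof -
  interpret T: pair_graph T by (rule pair_graph_T)
  interpret G: pair_graph G using graph_on_parent_tree_plus by (simp add: graph_on_def)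
  have "u \<rightarrow>\<^sup>*\<^bsub>with_proj G\<^esub> v" if "u < n" "v < n" for u v
    using reachable_T[OF that] unfolding reachable_def
    by (rule rtrancl_on_mono[rotated 2]) (auto simp: T_def parent_tree_plus_def)
  then show ?thesis
    unfolding Digraph_Component.connected_def strongly_connected_def
    using p_less G.reachable_mk_symmetric_eq[OF G.sym_arcs]
    by (auto simp: parent_tree_plus_def)
qed

lemma ex_cycle: "\<exists>C. C \<in> cycle_edge_sets G"
proof -
  interpret T: pair_graph T by (rule pair_graph_T)
  interpret G: pair_graph G using graph_on_parent_tree_plus by (simp add: graph_on_def)
  obtain c where c: "T.apath p c q"
    using reachable_T[OF p_less q_less] T.reachable_apath by auto
  have walk: "pcas p c q" "set c \<subseteq> parcs T" and dist: "distinct (pawalk_verts p c)"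
    using c by (auto simp: T.apath_def T.awalk_def)
  have "(p, q) \<notin> parcs T" using not_adj by (simp add: T_def)
  \<comment> \<open>The path is not empty because \<open>p \<noteq> q\<close>, and not a single arc
    because \<open>p\<close> and \<open>q\<close> are not adjacent in the tree. Closing it therefore
    gives length at least 3.\<close>
  with walk p_neq_q have len: "2 \<le> length c"
    by (cases c rule: list.exhaust; cases "tl c") auto
  have verts: "pawalk_verts x (c @ [(y, x')]) = pawalk_verts x c @ [x']" if "pcas x c y" for x x' y
    using that by (induction c arbitrary: x) auto
  have cas: "pcas x (c @ [(y, x')]) x'" if "pcas x c y" for x x' y
    using that by (induction c arbitrary: x) auto
  have "pawalk_verts p c = p # tl (pawalk_verts p c)"
    using walk by (cases c) auto
  with dist have "distinct (p # tl (pawalk_verts p c))" by metis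
  then have "distinct (tl (pawalk_verts p c) @ [p])" by simp
  moreover have "pawalk_verts p c \<noteq> []" by (cases c) auto
  ultimately have "distinct (tl (pawalk_verts p (c @ [(q, p)])))"
    using verts[OF walk(1)] by simp
  moreover have "G.awalk p (c @ [(q, p)]) p"
  proof -
    have "parcs T \<subseteq> parcs G" "(q, p) \<in> parcs G" "p \<in> pverts G"
      using p_less q_less by (auto simp: T_def parent_tree_plus_def)
    then show ?thesis
      using walk(2) cas[OF walk(1)] unfolding G.awalk_def by auto
  qed
  ultimately have "G.cycle (c @ [(q, p)])"
    by (auto simp: G.cycle_def)
  with len show ?thesis
    by (fastforce simp: cycle_edge_sets_def)
qed

lemma unicyclic_parent_tree_plus: "unicyclic G"
  unfolding unicyclic_def
  using connected_parent_tree_plus ex_cycle cycle_edges_unique by blast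

end

section \<open>Determinants and characteristic polynomials\<close>

lemma index_mult_mat_mat:
  fixes f g :: "nat \<Rightarrow> nat \<Rightarrow> 'a :: comm_semiring_0"
  shows "mat n m (\<lambda>(i, j). f i j) * mat m k (\<lambda>(i, j). g i j) = mat n k (\<lambda>(i, j). \<Sum>l<m. f i l * g l j)"
  by (rule eq_matI) (auto simp: scalar_prod_def lessThan_atLeast0)

text \<open>Sylvester's identity: \<open>?L * ?U\<close> and \<open>?V * ?L\<close> are the same
  block matrix, and \<open>?L\<close> has determinant 1.\<close>

lemma det_one_plus_mult_commute:
  fixes Y W :: "'a :: idom mat"
  assumes Y: "Y \<in> carrier_mat n m" and W: "W \<in> carrier_mat m n"
  shows "det (1\<^sub>m n + Y * W) = det (1\<^sub>m m + W * Y)"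
proof -
  let ?L = "four_block_mat (1\<^sub>m n) (0\<^sub>m n m) W (1\<^sub>m m)"
  let ?U = "four_block_mat (1\<^sub>m n) (- Y) (0\<^sub>m m n) (1\<^sub>m m + W * Y)"
  let ?V = "four_block_mat (1\<^sub>m n + Y * W) (- Y) (0\<^sub>m m n) (1\<^sub>m m)"
  have YW: "Y * W \<in> carrier_mat n n" and WY: "W * Y \<in> carrier_mat m m" using assms by auto
  have "W * - Y + (1\<^sub>m m + W * Y) = 1\<^sub>m m"
    using assms WY by (subst uminus_mult_right_mat) (auto intro!: eq_matI)
  then have 1: "?L * ?U = four_block_mat (1\<^sub>m n) (- Y) W (1\<^sub>m m)"
    using assms by (subst mult_four_block_mat[of _ n n _ m _ m _ _ n _ m]) auto
  have "1\<^sub>m n + Y * W + - Y * W = 1\<^sub>m n"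
    using assms YW by (subst uminus_mult_left_mat) (auto intro!: eq_matI)
  then have 2: "?V * ?L = four_block_mat (1\<^sub>m n) (- Y) W (1\<^sub>m m)"
    using assms by (subst mult_four_block_mat[of _ n n _ m _ m _ _ n _ m]) auto
  have L: "det ?L = 1"
    using W by (subst det_four_block_mat_upper_right_zero[where n = n and m = m]) auto
  have "det ?U = det (1\<^sub>m m + W * Y)" "det ?V = det (1\<^sub>m n + Y * W)"
    using assms by (subst det_four_block_mat_lower_left_zero[where n = n and m = m]; simp)+
  moreover have "det (?L * ?U) = det ?L * det ?U" "det (?V * ?L) = det ?V * det ?L"
    using assms by (intro det_mult[where n = "n + m"]; auto)+
  ultimately show ?thesis using 1 2 L by simp
qed

text \<open>The matrix determinant lemma: if A y = w, then A + w w^T = A (1 + y w^T). A solution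
  \<open>y\<close> takes the place of the inverse of A applied to \<open>w\<close>.\<close>

lemma det_add_rank_one:
  fixes f :: "nat \<Rightarrow> nat \<Rightarrow> real"
  assumes "\<And>i. i < n \<Longrightarrow> (\<Sum>l<n. f i l * y l) = w i"
  shows "det (mat n n (\<lambda>(i, j). f i j + w i * w j)) = det (mat n n (\<lambda>(i, j). f i j)) * (1 + (\<Sum>l<n. w l * y l))"
proof -
  let ?A = "mat n n (\<lambda>(i, j). f i j)"
  let ?Y = "mat n 1 (\<lambda>(i, j). y i)" and ?W = "mat 1 n (\<lambda>(i, j). w j)"
  have "mat n n (\<lambda>(i, j). f i j + w i * w j) = ?A + (?A * ?Y) * ?W"
    unfolding index_mult_mat_mat by (rule eq_matI) (auto simp: assms)
  also have "\<dots> = ?A + ?A * (?Y * ?W)"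
    by (subst assoc_mult_mat[of _ n n _ 1]) auto
  also have "\<dots> = ?A * (1\<^sub>m n + ?Y * ?W)"
    by (subst mult_add_distrib_mat[of _ n n _ n]) auto
  finally have "det (mat n n (\<lambda>(i, j). f i j + w i * w j)) = det ?A * det (1\<^sub>m n + ?Y * ?W)"
    by (metis (no_types, lifting) det_mult[of _ n] mat_carrier add_carrier_mat mult_carrier_mat)
  also have "det (1\<^sub>m n + ?Y * ?W) = det (1\<^sub>m 1 + ?W * ?Y)"
    by (rule det_one_plus_mult_commute) auto
  also have "1\<^sub>m 1 + ?W * ?Y = mat 1 1 (\<lambda>_. 1 + (\<Sum>l<n. w l * y l))"
    unfolding index_mult_mat_mat by (rule eq_matI) auto
  also have "det \<dots> = 1 + (\<Sum>l<n. w l * y l)"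
    by (subst det_single) auto
  finally show ?thesis .
qed

section \<open>Characteristic polynomials and spectra of real symmetric matrices\<close>

lemma poly_char_poly:
  fixes A :: "'a :: field mat"
  assumes "A \<in> carrier_mat n n"
  shows "poly (char_poly A) k = det (k \<cdot>\<^sub>m 1\<^sub>m n - A)"
proof -
  have "- char_matrix A k = k \<cdot>\<^sub>m 1\<^sub>m n - A"
    using assms by (intro eq_matI) (auto simp: char_matrix_def)
  then show ?thesis using char_poly_matrix[OF assms] by simp
qed

lemma split_poly_eq_prod_roots:
  fixes p :: "'a :: field poly"
  assumes "p \<noteq> 0" "size (proots p) = degree p"
  shows "p = Polynomial.smult (lead_coeff p) (\<Prod>a\<in>#proots p. [:- a, 1:])"
  using assms
proof (induction "degree p" arbitrary: p)
  case 0
  then show ?case by (auto elim!: degree_eq_zeroE)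
next
  case (Suc d)
  then obtain a where "a \<in># proots p"
    by (metis size_eq_Suc_imp_elem)
  then have "poly p a = 0" using Suc.prems by simp
  then obtain r where r: "p = [:- a, 1:] * r" by (metis poly_eq_0_iff_dvd dvdE)
  have "r \<noteq> 0" using r Suc.prems by auto
  have roots: "proots p = add_mset a (proots r)"
    unfolding r using \<open>r \<noteq> 0\<close> by (subst proots_mult) auto
  have deg: "degree p = Suc (degree r)" 
    unfolding r using \<open>r \<noteq> 0\<close> by (subst degree_mult_eq) auto
  have lc: "lead_coeff p = lead_coeff r"
    unfolding r lead_coeff_mult by simp
  have "r = Polynomial.smult (lead_coeff r) (\<Prod>a\<in>#proots r. [:- a, 1:])"
    using Suc \<open>r \<noteq> 0\<close> deg roots by simp
  then show ?case
    unfolding roots lc using r by (metis (no_types, lifting) image_mset_add_mset mult_smult_right prod_mset.add_mset)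
qed

text \<open>All roots are real, so the monic characteristic polynomial can be recovered from the
  multiset of its real roots. Cospectrality thus becomes equality of characteristic
  polynomials.\<close>

lemma char_poly_symmetric_eq_prod:
  fixes A :: "real mat"
  assumes "A \<in> carrier_mat n n"
    and "\<And>i j. i < n \<Longrightarrow> j < n \<Longrightarrow> A $$ (i, j) = A $$ (j, i)"
  shows "char_poly A = (\<Prod>a\<in>#proots (char_poly A). [:- a, 1:])"
proof -
  have *: "degree (char_poly A) = n" "monic (char_poly A)"
    using degree_monic_char_poly[OF assms(1)] by auto
  then have "char_poly A \<noteq> 0" by auto
  then show ?thesis
    using split_poly_eq_prod_roots[of "char_poly A"] size_proots_char_poly_symmetric[OF assms] * by simp
qed

lemma prod_mset_linear_nonzero: "(\<Prod>a\<in>#M. [:- a, 1:]) \<noteq> (0 :: 'a :: idom poly)"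
  by (auto simp: prod_mset_zero_iff)

lemma proots_prod_mset_linear:
  "proots (\<Prod>a\<in>#M. [:- a, 1:]) = (M :: 'a :: idom multiset)"
proof (induction M)
  case (add a M)
  have "proots ([:- a, 1:] * (\<Prod>a\<in>#M. [:- a, 1:])) = proots [:- a, 1:] + proots (\<Prod>a\<in>#M. [:- a, 1:])"
    by (rule proots_mult[OF _ prod_mset_linear_nonzero]) simp
  then show ?case using add by (simp del: mult_pCons_left)
qed simp

lemma degree_prod_mset_linear:
  "degree (\<Prod>a\<in>#M. [:- a, 1 :: 'a :: idom:]) = size M"
proof (induction M)
  case (add a M)
  have "degree ([:- a, 1:] * (\<Prod>a\<in>#M. [:- a, 1:])) = degree [:- a, 1:] + degree (\<Prod>a\<in>#M. [:- a, 1:])"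
    by (rule degree_mult_eq[OF _ prod_mset_linear_nonzero]) simp
  then show ?case using add by (simp del: mult_pCons_left)
qed simp

lemma poly_prod_mset_linear: "poly (\<Prod>a\<in>#M. [:- a, 1:]) t = (\<Prod>a\<in>#M. t - (a :: 'a :: comm_ring_1))"
  by (induction M) (auto simp: algebra_simps)

text \<open>Polynomials can thereby be compared at positive points only, where square roots exist
  and powers can be cancelled.\<close>

lemma poly_eqI_above:
  fixes p q :: "real poly"
  assumes "\<And>t. t > c \<Longrightarrow> poly p t = poly q t"
  shows "p = q"
proof (rule ccontr)
  assume "p \<noteq> q"
  then have "finite {t. poly (p - q) t = 0}" by (intro poly_roots_finite) simp
  moreover have "{c<..} \<subseteq> {t. poly (p - q) t = 0}" using assms by auto
  ultimately show False using infinite_Ioi finite_subset by blast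
qed

text \<open>With $x = t^2$, the matrix $x - B^2$ factors as $(t - B)(t + B)$.\<close>

lemma char_poly_square_shift:
  fixes A :: "real mat" and c :: real
  assumes A: "A \<in> carrier_mat n n"
    and eq: "char_poly A = (\<Prod>a\<in>#M. [:- a, 1:])"
  defines "B \<equiv> A - c \<cdot>\<^sub>m 1\<^sub>m n"
  shows "char_poly (B * B) = (\<Prod>a\<in>#M. [:- ((a - c)\<^sup>2), 1:])"
proof (rule poly_eqI_above[of 0])
  fix x :: real assume "x > 0"
  define t where "t = sqrt x"
  have x: "x = t * t" using \<open>x > 0\<close> by (simp add: t_def)
  have B: "B \<in> carrier_mat n n" unfolding B_def by (intro minus_carrier_mat) simp
  have "degree (char_poly A) = size M"
    unfolding eq by (rule degree_prod_mset_linear)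
  then have n: "size M = n" using degree_monic_char_poly[OF A] by simp
  have "(t \<cdot>\<^sub>m 1\<^sub>m n - B) * (t \<cdot>\<^sub>m 1\<^sub>m n + B) = (t \<cdot>\<^sub>m 1\<^sub>m n - B) * (t \<cdot>\<^sub>m 1\<^sub>m n) + (t \<cdot>\<^sub>m 1\<^sub>m n - B) * B"
    using B by (intro mult_add_distrib_mat[of _ n n _ n]) auto
  also have "(t \<cdot>\<^sub>m 1\<^sub>m n - B) * (t \<cdot>\<^sub>m 1\<^sub>m n) = t \<cdot>\<^sub>m (t \<cdot>\<^sub>m 1\<^sub>m n - B)"
    using B by (subst mult_smult_distrib[of _ n n _ n]) auto
  also have "(t \<cdot>\<^sub>m 1\<^sub>m n - B) * B = t \<cdot>\<^sub>m B - B * B"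
    using B by (subst minus_mult_distrib_mat[of _ n n _ _ n]) (auto simp: mult_smult_assoc_mat[of _ n n _ n])
  also have "t \<cdot>\<^sub>m (t \<cdot>\<^sub>m 1\<^sub>m n - B) + (t \<cdot>\<^sub>m B - B * B) = x \<cdot>\<^sub>m 1\<^sub>m n - B * B"
    using B by (intro eq_matI) (auto simp: x algebra_simps)
  finally have fac: "x \<cdot>\<^sub>m 1\<^sub>m n - B * B = (t \<cdot>\<^sub>m 1\<^sub>m n - B) * (t \<cdot>\<^sub>m 1\<^sub>m n + B)" ..
  have "t \<cdot>\<^sub>m 1\<^sub>m n - B = (t + c) \<cdot>\<^sub>m 1\<^sub>m n - A"
    using A by (intro eq_matI) (auto simp: B_def algebra_simps)
  then have 1: "det (t \<cdot>\<^sub>m 1\<^sub>m n - B) = (\<Prod>a\<in>#M. t + c - a)"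
    using poly_char_poly[OF A, of "t + c"] by (simp add: eq poly_prod_mset_linear)
  have "t \<cdot>\<^sub>m 1\<^sub>m n + B = (-1) \<cdot>\<^sub>m ((c - t) \<cdot>\<^sub>m 1\<^sub>m n - A)"
    using A by (intro eq_matI) (auto simp: B_def algebra_simps)
  then have "det (t \<cdot>\<^sub>m 1\<^sub>m n + B) = (-1) ^ n * (\<Prod>a\<in>#M. c - t - a)"
    using poly_char_poly[OF A, of "c - t"] A by (simp add: eq poly_prod_mset_linear)
  \<comment> \<open>As \<open>M\<close> has exactly \<open>n\<close> elements, the sign is absorbed
    by negating each factor.\<close>
  also have "\<dots> = (\<Prod>a\<in>#M. t + a - c)"
    unfolding n[symmetric] by (induction M) (auto simp: algebra_simps)
  finally have 2: "det (t \<cdot>\<^sub>m 1\<^sub>m n + B) = (\<Prod>a\<in>#M. t + a - c)" .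
  have "poly (char_poly (B * B)) x = det (x \<cdot>\<^sub>m 1\<^sub>m n - B * B)"
    using B by (intro poly_char_poly) auto
  also have "\<dots> = (\<Prod>a\<in>#M. t + c - a) * (\<Prod>a\<in>#M. t + a - c)"
    unfolding fac using B 1 2 by (subst det_mult[of _ n]) auto
  also have "\<dots> = (\<Prod>a\<in>#M. x - (a - c)\<^sup>2)"
    unfolding prod_mset.distrib[symmetric] x
    by (intro arg_cong[of _ _ prod_mset] image_mset_cong) (simp add: algebra_simps power2_eq_square)
  also have "\<dots> = poly (\<Prod>a\<in>#M. [:- ((a - c)\<^sup>2), 1:]) x"
    by (induction M) (auto simp: algebra_simps)
  finally show "poly (char_poly (B * B)) x = poly (\<Prod>a\<in>#M. [:- ((a - c)\<^sup>2), 1:]) x" .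
qed

text \<open>The eigenvalues of \<open>B * B\<close> are the squares of \<open>\<mu> - c\<close>, and
  the square root of such a square is the absolute value.\<close>

lemma sum_abs_eigenvalue_deviation:
  fixes A :: "real mat" and c :: real
  assumes A: "A \<in> carrier_mat n n"
    and sym: "\<And>i j. i < n \<Longrightarrow> j < n \<Longrightarrow> A $$ (i, j) = A $$ (j, i)"
  defines "B \<equiv> A - c \<cdot>\<^sub>m 1\<^sub>m n"
  shows "(\<Sum>\<mu>\<in>#proots (char_poly A). \<bar>\<mu> - c\<bar>) = (\<Sum>\<nu>\<in>#proots (char_poly (B * B)). sqrt \<nu>)"
proof -
  let ?M = "proots (char_poly A)"
  have "char_poly (B * B) = (\<Prod>a\<in>#image_mset (\<lambda>a. (a - c)\<^sup>2) ?M. [:- a, 1:])"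
    unfolding B_def
    by (subst char_poly_square_shift[OF A char_poly_symmetric_eq_prod[OF A sym]])
      (auto simp: image_mset.compositionality comp_def)
  then have "proots (char_poly (B * B)) = image_mset (\<lambda>a. (a - c)\<^sup>2) ?M"
    by (simp only: proots_prod_mset_linear)
  then show ?thesis by (simp add: image_mset.compositionality comp_def)
qed

text \<open>As $L J = 0$, we have $(x - L)(x - J) = x (x - (L + J))$.\<close>

lemma det_add_const_eq_if_char_poly_eq:
  fixes L1 L2 J :: "real mat"
  assumes L: "L1 \<in> carrier_mat n n" "L2 \<in> carrier_mat n n" and J: "J \<in> carrier_mat n n"
    and zero: "L1 * J = 0\<^sub>m n n" "L2 * J = 0\<^sub>m n n"
    and eq: "char_poly L1 = char_poly L2"
  shows "det (L1 + J) = det (L2 + J)"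
proof -
  have key: "poly (char_poly L) x * poly (char_poly J) x = x ^ n * poly (char_poly (L + J)) x"
    if L: "L \<in> carrier_mat n n" and z: "L * J = 0\<^sub>m n n" for L x
  proof -
    have "(x \<cdot>\<^sub>m 1\<^sub>m n - L) * (x \<cdot>\<^sub>m 1\<^sub>m n - J) = (x \<cdot>\<^sub>m 1\<^sub>m n - L) * (x \<cdot>\<^sub>m 1\<^sub>m n) - (x \<cdot>\<^sub>m 1\<^sub>m n - L) * J"
      using L J by (intro mult_minus_distrib_mat[of _ n n _ n]) auto
    also have "(x \<cdot>\<^sub>m 1\<^sub>m n - L) * (x \<cdot>\<^sub>m 1\<^sub>m n) = x \<cdot>\<^sub>m (x \<cdot>\<^sub>m 1\<^sub>m n - L)"
      using L by (subst mult_smult_distrib[of _ n n _ n]) auto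
    also have "(x \<cdot>\<^sub>m 1\<^sub>m n - L) * J = x \<cdot>\<^sub>m J"
      using L J z by (subst minus_mult_distrib_mat[of _ n n _ _ n]) (auto simp: mult_smult_assoc_mat[of _ n n _ n])
    also have "x \<cdot>\<^sub>m (x \<cdot>\<^sub>m 1\<^sub>m n - L) - x \<cdot>\<^sub>m J = x \<cdot>\<^sub>m (x \<cdot>\<^sub>m 1\<^sub>m n - (L + J))"
      using L J by (intro eq_matI) (auto simp: algebra_simps)
    finally have "det (x \<cdot>\<^sub>m 1\<^sub>m n - L) * det (x \<cdot>\<^sub>m 1\<^sub>m n - J) = det (x \<cdot>\<^sub>m (x \<cdot>\<^sub>m 1\<^sub>m n - (L + J)))"
      using L J by (subst det_mult[of _ n, symmetric]) auto
    then show ?thesis using L J by (simp add: poly_char_poly[of _ n])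
  qed
  have "char_poly (L1 + J) = char_poly (L2 + J)"
  proof (rule poly_eqI_above[of 0])
    fix x :: real assume "x > 0"
    then show "poly (char_poly (L1 + J)) x = poly (char_poly (L2 + J)) x"
      using key[OF L(1) zero(1), of x] key[OF L(2) zero(2), of x] eq by simp
  qed
  \<comment> \<open>Evaluation at 0 gives both determinants up to the common sign
    \<open>(-1) ^ n\<close>.\<close>
  then have "det (0 \<cdot>\<^sub>m 1\<^sub>m n - (L1 + J)) = det (0 \<cdot>\<^sub>m 1\<^sub>m n - (L2 + J))"
    using L J by (metis poly_char_poly add_carrier_mat)
  moreover have "0 \<cdot>\<^sub>m 1\<^sub>m n - (L + J) = (-1) \<cdot>\<^sub>m (L + J)" if "L \<in> carrier_mat n n" for L
    using that J by (intro eq_matI) auto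
  ultimately show ?thesis using L J by simp
qed

text \<open>Relabelling by an involution is conjugation by its permutation matrix, which is its own
  inverse.\<close>

lemma char_poly_permute:
  fixes f :: "nat \<Rightarrow> nat \<Rightarrow> 'a :: field"
  assumes t: "\<And>i. i < n \<Longrightarrow> \<tau> i < n" "\<And>i. i < n \<Longrightarrow> \<tau> (\<tau> i) = i"
  shows "char_poly (mat n n (\<lambda>(i, j). f (\<tau> i) (\<tau> j))) = char_poly (mat n n (\<lambda>(i, j). f i j))"
proof (rule char_poly_similar)
  define g where "g i j = (if j = \<tau> i then 1 else 0 :: 'a)" for i j
  let ?P = "mat n n (\<lambda>(i, j). g i j)"
  have left: "(\<Sum>l<n. g i l * h l) = h (\<tau> i)" if "i < n" for i h
    using t(1)[OF that] by (simp add: g_def if_distrib[of "\<lambda>x. x * _"] sum.delta cong: if_cong)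
  have eq: "j = \<tau> i \<longleftrightarrow> i = \<tau> j" if "i < n" "j < n" for i j
    using t that by metis
  have right: "(\<Sum>l<n. h l * g l j) = h (\<tau> j)" if "j < n" for j h
  proof -
    have "(\<Sum>l<n. h l * g l j) = (\<Sum>l<n. if l = \<tau> j then h l else 0)"
      using eq that by (intro sum.cong) (auto simp: g_def)
    then show ?thesis using t(1)[OF that] by simp
  qed
  have "(\<Sum>l<n. g i l * g l j) = (if i = j then 1 else 0)" if "i < n" for i j
    using t(2)[OF that] left[OF that] by (auto simp: g_def)
  then have PP: "?P * ?P = 1\<^sub>m n"
    unfolding index_mult_mat_mat by (intro eq_matI) auto
  have "?P * mat n n (\<lambda>(i, j). f i j) * ?P = mat n n (\<lambda>(i, j). \<Sum>l<n. (\<Sum>k<n. g i k * f k l) * g l j)"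
    unfolding index_mult_mat_mat ..
  also have "\<dots> = mat n n (\<lambda>(i, j). f (\<tau> i) (\<tau> j))"
    by (intro eq_matI) (auto simp: left right)
  finally show "similar_mat (mat n n (\<lambda>(i, j). f (\<tau> i) (\<tau> j))) (mat n n (\<lambda>(i, j). f i j))"
    using PP by (intro similar_matI[of _ _ ?P ?P n]) auto
qed

section \<open>The Laplacian of a tree plus an edge\<close>

text \<open>Entries are functions of the labels rather than matrices, so that sums over rows can be
  rewritten directly.\<close>

definition tree_adj :: "(nat \<Rightarrow> nat) \<Rightarrow> nat \<Rightarrow> nat \<Rightarrow> real" where
  "tree_adj par u v = of_bool (parent_adj par u v)"

definition tree_lap :: "(nat \<Rightarrow> nat) \<Rightarrow> nat \<Rightarrow> nat \<Rightarrow> nat \<Rightarrow> real" where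
  "tree_lap par n u v = (if u = v then \<Sum>w<n. tree_adj par u w else 0) - tree_adj par u v"

lemma tree_adj_sym: "tree_adj par u v = tree_adj par v u"
  by (auto simp: tree_adj_def parent_adj_def)

lemma tree_lap_sym: "tree_lap par n u v = tree_lap par n v u"
  by (auto simp: tree_lap_def tree_adj_sym)

lemma sum_tree_lap:
  assumes "u < n"
  shows "(\<Sum>v<n. tree_lap par n u v * h v) = (\<Sum>v<n. tree_adj par u v * (h u - h v))"
proof -
  have "(\<Sum>v<n. tree_lap par n u v * h v) =
      (\<Sum>v<n. (if u = v then (\<Sum>w<n. tree_adj par u w) * h v else 0) - tree_adj par u v * h v)"
    by (intro sum.cong) (auto simp: tree_lap_def algebra_simps)
  also have "\<dots> = (\<Sum>v<n. tree_adj par u v * (h u - h v))"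
    using assms by (simp add: sum_subtractf right_diff_distrib sum_distrib_right)
  finally show ?thesis .
qed

lemma sum_tree_lap_row: "u < n \<Longrightarrow> (\<Sum>v<n. tree_lap par n u v) = 0"
  using sum_tree_lap[of u n par "\<lambda>_. 1"] by simp

text \<open>The neighbours of \<open>u\<close> are its parent and its children; no vertex is both,
  as parents have smaller labels.\<close>

lemma sum_tree_adj:
  assumes "\<And>v. 0 < v \<Longrightarrow> par v < v" and "u < n"
  shows "(\<Sum>v<n. tree_adj par u v * h v) =
    of_bool (0 < u) * h (par u) + (\<Sum>v<n. of_bool (0 < v \<and> par v = u) * h v)"
proof -
  have "tree_adj par u v * h v = (if v = par u then of_bool (0 < u) * h (par u) else 0) +
      of_bool (0 < v \<and> par v = u) * h v" for v
    using assms(1)[of u] assms(1)[of v]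
    by (cases "u = 0"; cases "v = 0") (auto simp: tree_adj_def parent_adj_def)
  moreover have "0 < u \<Longrightarrow> par u < n" using assms(1)[of u] assms(2) by simp
  ultimately show ?thesis by (cases "u = 0") (simp_all add: sum.distrib)
qed

text \<open>Each of the \<open>n - 1\<close> vertices other than the root contributes the edge to
  its parent, counted from both ends.\<close>

lemma sum_sum_tree_adj:
  assumes "\<And>v. 0 < v \<Longrightarrow> par v < v" and "0 < n"
  shows "(\<Sum>u<n. \<Sum>v<n. tree_adj par u v) = 2 * (real n - 1)"
proof -
  have pos: "(\<Sum>u<n. of_bool (0 < u)) = real n - 1"
  proof -
    obtain k where "n = Suc k" using assms(2) by (cases n) auto
    then show ?thesis by (simp only: sum.lessThan_Suc_shift) simp
  qed
  have "(\<Sum>u<n. \<Sum>v<n. of_bool (0 < v \<and> par v = u)) = (\<Sum>v<n. \<Sum>u<n. of_bool (0 < v \<and> par v = u) :: real)"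
    by (rule sum.swap)
  also have "\<dots> = (\<Sum>v<n. of_bool (0 < v))"
  proof (rule sum.cong)
    fix v assume v: "v \<in> {..<n}"
    have "(\<Sum>u<n. of_bool (0 < v \<and> par v = u) :: real) = (\<Sum>u<n. if u = par v then of_bool (0 < v) else 0)"
      by (intro sum.cong) auto
    then show "(\<Sum>u<n. of_bool (0 < v \<and> par v = u) :: real) = of_bool (0 < v)"
      using v assms(1)[of v] by (cases "v = 0") auto
  qed simp
  finally show ?thesis
    using sum_tree_adj[OF assms(1), of _ n "\<lambda>_. 1"] pos by (simp add: sum.distrib)
qed

text \<open>A kernel vector of L + J has entry sum 0, hence lies in the kernel of L. On a tree it is
  then constant, and a constant vector with sum 0 vanishes.\<close>

lemma det_tree_lap_plus_ones_nonzero: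
  assumes par: "\<And>v. 0 < v \<Longrightarrow> par v < v"
  shows "det (mat n n (\<lambda>(i, j). tree_lap par n i j + 1)) \<noteq> 0"
proof
  let ?A = "mat n n (\<lambda>(i, j). tree_lap par n i j + 1)"
  assume "det ?A = 0"
  then obtain v where v: "v \<in> carrier_vec n" "v \<noteq> 0\<^sub>v n" "?A *\<^sub>v v = 0\<^sub>v n"
    using det_0_iff_vec_prod_zero[of ?A n] by auto
  define z where "z = (\<lambda>i. v $ i)"
  define S where "S = (\<Sum>i<n. z i)"
  have "(\<Sum>l<n. (tree_lap par n i l + 1) * z l) = 0" if "i < n" for i
    using arg_cong[OF v(3), of "\<lambda>x. x $ i"] that v(1)
    by (simp add: scalar_prod_def z_def lessThan_atLeast0)
  then have row: "(\<Sum>l<n. tree_lap par n i l * z l) = - S" if "i < n" for i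
    using that by (simp add: algebra_simps sum.distrib S_def eq_neg_iff_add_eq_0)
  have "(\<Sum>i<n. \<Sum>l<n. tree_lap par n i l * z l) = (\<Sum>l<n. \<Sum>i<n. tree_lap par n l i * z l)"
    by (subst sum.swap) (simp add: tree_lap_sym[of par n])
  also have "\<dots> = 0"
    by (simp add: sum_tree_lap_row flip: sum_distrib_right)
  \<comment> \<open>Every row of L z equals \<open>- S\<close>, while all column sums of L are 0; so
    \<open>n\<close> times \<open>S\<close> is 0.\<close>
  finally have S: "S = 0"
    using row by (cases "n = 0") (auto simp: S_def)
  \<comment> \<open>The induction runs from the largest labels down: once all children of
    \<open>u\<close> agree with \<open>u\<close>, the equation at \<open>u\<close> leaves only the
    difference to its parent.\<close>
  have zpar: "z u = z (par u)" if "0 < u" "u < n" for u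
    using that
  proof (induction "n - u" arbitrary: u rule: less_induct)
    case less
    have child: "z w = z u" if "0 < w \<and> par w = u" "w < n" for w
      using less.hyps[of w] that par[of w] by auto
    have "0 = (\<Sum>v<n. tree_adj par u v * (z u - z v))"
      using row[OF less.prems(2)] S sum_tree_lap[OF less.prems(2)] by simp
    also have "\<dots> = z u - z (par u) + (\<Sum>v<n. of_bool (0 < v \<and> par v = u) * (z u - z v))"
      using sum_tree_adj[OF par less.prems(2)] less.prems(1) by simp
    also have "(\<Sum>v<n. of_bool (0 < v \<and> par v = u) * (z u - z v)) = 0"
    proof (intro sum.neutral ballI)
      fix v assume "v \<in> {..<n}"
      then show "of_bool (0 < v \<and> par v = u) * (z u - z v) = 0"
        using child[of v] by (cases "0 < v \<and> par v = u") simp_all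
    qed
    finally show ?case by simp
  qed
  have const: "z u = z 0" if "u < n" for u
    using that
  proof (induction u rule: less_induct)
    case (less u)
    show ?case
    proof (cases "u = 0")
      case False
      then have "z u = z (par u)" using zpar less.prems by simp
      also have "\<dots> = z 0" using False par[of u] less.prems by (intro less.IH) auto
      finally show ?thesis .
    qed simp
  qed
  have "S = (\<Sum>u<n. z 0)" unfolding S_def by (intro sum.cong refl) (rule const, simp)
  then have "z 0 = 0" if "u < n" for u :: nat using S that by simp
  then have "z u = 0" if "u < n" for u using const[OF that] that by metis
  then have "v = 0\<^sub>v n" using v(1) by (intro eq_vecI) (auto simp: z_def)
  then show False using v(2) by simp
qed

section \<open>The Laplacian after adding the extra edge\<close>

context parent_tree_edge
begin

text \<open>The signed incidence vector of the extra edge; its outer product with itself is the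
  Laplacian of that edge alone.\<close>

definition chord :: "nat \<Rightarrow> real" where
  "chord v = of_bool (v = p) - of_bool (v = q)"

lemma sum_chord: "(\<Sum>v<n. chord v) = 0"
  using p_less q_less by (simp add: chord_def sum_subtractf of_bool_def)

lemma arc_indicator:
  assumes "u < n" "v < n"
  shows "of_bool ((u, v) \<in> parcs G) = tree_adj par u v + of_bool (u = p \<and> v = q) + of_bool (u = q \<and> v = p)"
  using assms not_adj parent_adj_sym p_neq_q
  by (auto simp: parent_tree_plus_def tree_adj_def)

lemma degree_parent_tree_plus:
  assumes "u < n"
  shows "real (degree_of G u) = (\<Sum>v<n. tree_adj par u v) + of_bool (u = p) + of_bool (u = q)"
proof -
  have "out_arcs (with_proj G) u = Pair u ` {v. v < n \<and> (u, v) \<in> parcs G}"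
    by (auto simp: out_arcs_def parent_tree_plus_def)
  then have "degree_of G u = card {v. v < n \<and> (u, v) \<in> parcs G}"
    by (simp add: out_degree_def card_image inj_on_def)
  also have "real \<dots> = (\<Sum>v<n. of_bool ((u, v) \<in> parcs G))"
    by (simp add: of_bool_def sum.If_cases Int_def lessThan_def)
  also have "\<dots> = (\<Sum>v<n. tree_adj par u v + of_bool (u = p \<and> v = q) + of_bool (u = q \<and> v = p))"
    using assms by (intro sum.cong) (auto simp: arc_indicator)
  also have "\<dots> = (\<Sum>v<n. tree_adj par u v) + of_bool (u = p) + of_bool (u = q)"
    using p_less q_less by (auto simp: sum.distrib of_bool_def)
  finally show ?thesis .
qed

text \<open>There are as many edges as vertices: \<open>n - 1\<close> in the tree and one
  more.\<close>

lemma average_degree_parent_tree_plus: "average_degree G = 2"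
proof -
  have "(\<Sum>v\<in>pverts G. real (degree_of G v)) =
      (\<Sum>u<n. (\<Sum>v<n. tree_adj par u v) + of_bool (u = p) + of_bool (u = q))"
    by (intro sum.cong) (auto simp: parent_tree_plus_def degree_parent_tree_plus[unfolded parent_tree_plus_def])
  also have "\<dots> = 2 * real n"
    using sum_sum_tree_adj[OF par_less, of n] p_less q_less
    by (simp add: sum.distrib of_bool_def)
  finally show ?thesis
    using p_less by (simp add: average_degree_def) (simp add: parent_tree_plus_def)
qed

lemma laplacian_parent_tree_plus:
  "laplacian_matrix G = mat n n (\<lambda>(i, j). tree_lap par n i j + chord i * chord j)"
proof (rule eq_matI)
  have n: "num_verts G = n" by (simp add: parent_tree_plus_def)
  fix i j assume "i < dim_row (mat n n (\<lambda>(i, j). tree_lap par n i j + chord i * chord j))"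
    "j < dim_col (mat n n (\<lambda>(i, j). tree_lap par n i j + chord i * chord j))"
  then have ij: "i < n" "j < n" by auto
  have "laplacian_matrix G $$ (i, j) = (if i = j then real (degree_of G i) else 0) - of_bool ((i, j) \<in> parcs G)"
    using ij by (simp add: laplacian_matrix_def degree_matrix_def adjacency_matrix_def n of_bool_def)
  also have "\<dots> = tree_lap par n i j + chord i * chord j"
    using ij p_neq_q by (auto simp: degree_parent_tree_plus arc_indicator tree_lap_def chord_def)
  finally show "laplacian_matrix G $$ (i, j) = mat n n (\<lambda>(i, j). tree_lap par n i j + chord i * chord j) $$ (i, j)"
    using ij by simp
qed (simp_all add: laplacian_matrix_def degree_matrix_def adjacency_matrix_def parent_tree_plus_def)

lemma laplacian_carrier: "laplacian_matrix G \<in> carrier_mat n n"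
  by (simp add: laplacian_parent_tree_plus)

lemma laplacian_sym:
  "i < n \<Longrightarrow> j < n \<Longrightarrow> laplacian_matrix G $$ (i, j) = laplacian_matrix G $$ (j, i)"
  by (simp add: laplacian_parent_tree_plus tree_lap_sym)

lemma laplacian_mult_ones: "laplacian_matrix G * mat n n (\<lambda>_. 1) = 0\<^sub>m n n"
proof -
  have "laplacian_matrix G * mat n n (\<lambda>(i, j). 1) = mat n n (\<lambda>(i, j). \<Sum>l<n. (tree_lap par n i l + chord i * chord l) * 1)"
    unfolding laplacian_parent_tree_plus index_mult_mat_mat ..
  also have "\<dots> = 0\<^sub>m n n"
    by (rule eq_matI) (auto simp: sum.distrib sum_tree_lap_row sum_chord simp flip: sum_distrib_left)
  finally show ?thesis by (simp add: case_prod_unfold)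
qed

text \<open>The edge is a rank-one update by \<open>chord\<close>. With \<open>y\<close> as a
  potential for unit current, \<open>y p - y q\<close> is the effective resistance between
  \<open>p\<close> and \<open>q\<close>.\<close>

lemma det_laplacian_plus_ones:
  assumes "\<And>i. i < n \<Longrightarrow> (\<Sum>l<n. (tree_lap par n i l + 1) * y l) = chord i"
  shows "det (laplacian_matrix G + mat n n (\<lambda>_. 1)) =
    det (mat n n (\<lambda>(i, j). tree_lap par n i j + 1)) * (1 + y p - y q)"
proof -
  have "laplacian_matrix G + mat n n (\<lambda>_. 1) = mat n n (\<lambda>(i, j). (tree_lap par n i j + 1) + chord i * chord j)"
    unfolding laplacian_parent_tree_plus by (rule eq_matI) auto
  moreover have "(\<Sum>l<n. chord l * y l) = y p - y q"
    using p_less q_less by (simp add: chord_def of_bool_def left_diff_distrib sum_subtractf if_distrib[of "\<lambda>x. x * _"] cong: if_cong)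
  ultimately show ?thesis
    using det_add_rank_one[of n "\<lambda>i l. tree_lap par n i l + 1" y chord] assms by simp
qed

end

section \<open>Closing a pair of legs\<close>

text \<open>
  Two pendant paths with \<^term>\<open>m\<close> vertices each, hanging from the vertex 0: one on the odd labels
  $s+1, s+3, \dots, s+2m-1$, the other on the even labels $s+2, s+4, \dots, s+2m$.
\<close>

locale leg_pair =
  fixes par :: "nat \<Rightarrow> nat" and n s m :: nat
  assumes par_less: "\<And>v. 0 < v \<Longrightarrow> par v < v"
    and even_s: "even s" and m_pos: "0 < m" and leg_end: "s + 2 * m < n"
    and par_start: "par (s + 1) = 0" "par (s + 2) = 0"
    and par_step: "\<And>v. s + 2 < v \<Longrightarrow> v \<le> s + 2 * m \<Longrightarrow> par v = v - 2"
    and par_outside: "\<And>v. 0 < v \<Longrightarrow> \<not> (s < v \<and> v \<le> s + 2 * m) \<Longrightarrow> \<not> (s < par v \<and> par v \<le> s + 2 * m)"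
begin

definition leg :: "nat \<Rightarrow> bool" where
  "leg v \<longleftrightarrow> s < v \<and> v \<le> s + 2 * m"

text \<open>The automorphism swapping the two legs. As \<open>s\<close> is even, vertices at equal
  distance from 0 are an odd label and its successor.\<close>

definition mirror :: "nat \<Rightarrow> nat" where
  "mirror v = (if leg v then if odd v then v + 1 else v - 1 else v)"

text \<open>The position on the leg, counted from 0. Off the legs \<open>twist\<close> and
  \<open>cotwist\<close> are the identity whatever its value, since \<open>mirror\<close>
  is.\<close>

definition depth :: "nat \<Rightarrow> nat" where
  "depth v = (v - s - 1) div 2"

text \<open>
  Twisting every second rung turns a product of a matrix with the permutation \<^const>\<open>mirror\<close> back into
  the standard labelling, where the two legs do not cross.
\<close>

definition twist :: "nat \<Rightarrow> nat" where
  "twist v = (if odd (depth v) then mirror v else v)"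

definition cotwist :: "nat \<Rightarrow> nat" where
  "cotwist v = (if odd (depth v) then v else mirror v)"

lemma leg_mirror [simp]: "leg (mirror v) \<longleftrightarrow> leg v"
  using even_s by (auto simp: leg_def mirror_def; presburger)

lemma mirror_mirror [simp]: "mirror (mirror v) = v"
proof (cases "leg v")
  case True
  then have "leg (mirror v)" by simp
  then show ?thesis using True by (auto simp: mirror_def leg_def)
qed (simp add: mirror_def)

lemma depth_mirror [simp]: "depth (mirror v) = depth v"
proof (cases "leg v")
  case True
  then obtain d where "v = s + Suc d"
    unfolding leg_def by (metis less_imp_Suc_add add_Suc_right)
  then show ?thesis
    using even_s True by (auto simp: mirror_def depth_def elim!: evenE oddE)
qed (simp add: mirror_def)

lemma twist_twist [simp]: "twist (twist v) = v"
  and cotwist_cotwist [simp]: "cotwist (cotwist v) = v"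
  and twist_mirror: "twist (mirror v) = cotwist v"
  and mirror_twist: "mirror (twist v) = cotwist v"
  and mirror_cotwist: "mirror (cotwist v) = twist v"
  by (simp_all add: twist_def cotwist_def)

lemma leg_0 [simp]: "\<not> leg 0"
  by (simp add: leg_def)

lemma mirror_pos: "0 < mirror v \<longleftrightarrow> 0 < v"
proof (cases "leg v")
  case True
  then show ?thesis using leg_mirror[of v] by (auto simp: leg_def)
qed (simp add: mirror_def)

lemma mirror_less: "v < n \<Longrightarrow> mirror v < n"
  using leg_mirror[of v] leg_end by (cases "leg v") (auto simp: leg_def mirror_def)

lemma twist_less: "v < n \<Longrightarrow> twist v < n" and cotwist_less: "v < n \<Longrightarrow> cotwist v < n"
  by (simp_all add: twist_def cotwist_def mirror_less)

lemma par_leg: "leg v \<Longrightarrow> par v = (if depth v = 0 then 0 else v - 2)"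
proof -
  assume v: "leg v"
  consider "v = s + 1" | "v = s + 2" | "s + 2 < v" using v unfolding leg_def by linarith
  then show ?thesis
  proof cases
    case 3
    then have "par v = v - 2" using par_step v by (simp add: leg_def)
    then show ?thesis using 3 by (auto simp: depth_def)
  qed (use par_start in \<open>auto simp: depth_def\<close>)
qed

lemma par_not_leg: "0 < v \<Longrightarrow> \<not> leg v \<Longrightarrow> \<not> leg (par v)"
  using par_outside by (simp add: leg_def)

lemma leg_parent:
  assumes "leg v" "depth v \<noteq> 0"
  shows "leg (v - 2)" "depth (v - 2) = depth v - 1" "mirror (v - 2) = mirror v - 2"
  using assms by (auto simp: leg_def depth_def mirror_def)

lemma par_mirror: "0 < v \<Longrightarrow> par (mirror v) = mirror (par v)"
proof (cases "leg v")
  case True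
  then show ?thesis
    by (cases "depth v = 0") (simp_all add: par_leg leg_parent mirror_def[of 0])
next
  case False
  assume "0 < v"
  then show ?thesis using False par_not_leg by (simp add: mirror_def)
qed

text \<open>Passing to the parent along a leg flips the parity of \<open>depth\<close>, which
  exchanges the roles of \<open>twist\<close> and \<open>cotwist\<close>.\<close>

lemma par_cotwist: "0 < v \<Longrightarrow> par (cotwist v) = twist (par v)"
proof (cases "leg v")
  case True
  assume "0 < v"
  show ?thesis
  proof (cases "depth v = 0")
    case True
    then show ?thesis
      using \<open>leg v\<close> by (simp add: par_leg cotwist_def twist_def mirror_def[of 0])
  next
    case False
    then have "odd (depth (v - 2)) \<longleftrightarrow> even (depth v)"
      using leg_parent(2)[OF True False] by simp
    then show ?thesis
      using True False leg_parent(3)[OF True False]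
      by (simp add: par_leg cotwist_def twist_def)
  qed
next
  case False
  assume "0 < v"
  then show ?thesis using False par_not_leg
    by (simp add: mirror_def twist_def cotwist_def)
qed

lemma cotwist_pos: "0 < cotwist v \<longleftrightarrow> 0 < v" and twist_pos: "0 < twist v \<longleftrightarrow> 0 < v"
  by (simp_all add: cotwist_def twist_def mirror_pos)

lemma par_twist: "0 < v \<Longrightarrow> par (twist v) = cotwist (par v)"
  using par_cotwist[of v] par_mirror[of "cotwist v"]
  by (simp add: mirror_cotwist mirror_twist cotwist_pos)

lemma mirror_eq_iff [simp]: "mirror u = mirror v \<longleftrightarrow> u = v"
  and twist_eq_iff [simp]: "twist u = twist v \<longleftrightarrow> u = v"
  and cotwist_eq_iff [simp]: "cotwist u = cotwist v \<longleftrightarrow> u = v"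
  by (metis mirror_mirror, metis twist_twist, metis cotwist_cotwist)

lemma tree_adj_mirror: "tree_adj par (mirror u) (mirror v) = tree_adj par u v"
  unfolding tree_adj_def parent_adj_def
  by (cases "0 < u"; cases "0 < v") (simp_all add: par_mirror mirror_pos)

text \<open>As \<open>cotwist v\<close> is \<open>mirror (twist v)\<close>, this says that A P,
  relabelled by \<open>twist\<close>, is again A, for the adjacency matrix A of the tree and the
  permutation matrix P of \<open>mirror\<close>.\<close>

lemma tree_adj_twist: "tree_adj par (twist u) (cotwist v) = tree_adj par u v"
  unfolding tree_adj_def parent_adj_def
  by (cases "0 < u"; cases "0 < v") (simp_all add: par_twist par_cotwist twist_pos cotwist_pos)

lemma children_leg:
  assumes "leg u"
  shows "(\<Sum>v<n. of_bool (0 < v \<and> par v = u) * h v) = (if leg (u + 2) then h (u + 2) else (0 :: real))"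
proof -
  have "0 < v \<and> par v = u \<longleftrightarrow> leg (u + 2) \<and> v = u + 2" for v
  proof
    assume *: "0 < v \<and> par v = u"
    then have "leg v" using par_not_leg assms by blast
    moreover have "depth v \<noteq> 0"
    proof
      assume "depth v = 0"
      then have "u = 0" using * par_leg[OF \<open>leg v\<close>] by simp
      then show False using assms by simp
    qed
    ultimately have "par v = v - 2" "2 < v"
      using par_leg[of v] by (auto simp: depth_def leg_def)
    then have "v = u + 2" using * by simp
    then show "leg (u + 2) \<and> v = u + 2" using \<open>leg v\<close> by simp
  next
    assume *: "leg (u + 2) \<and> v = u + 2"
    then have "depth v \<noteq> 0" using assms by (auto simp: leg_def depth_def)
    then show "0 < v \<and> par v = u" using * par_leg[of v] by simp
  qed
  then have "(\<Sum>v<n. of_bool (0 < v \<and> par v = u) * h v) = (\<Sum>v<n. if v = u + 2 then of_bool (leg (u + 2)) * h v else 0)"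
    by (intro sum.cong) auto
  also have "\<dots> = (if leg (u + 2) then h (u + 2) else 0)"
    using leg_end by (auto simp: leg_def)
  finally show ?thesis .
qed

abbreviation "p \<equiv> s + 2 * m - 1"
abbreviation "q \<equiv> s + 2 * m"

lemma parent_tree_edge: "parent_tree_edge par n p q"
proof
  have "leg q" "leg p" using m_pos by (auto simp: leg_def)
  then have "par q \<noteq> p" "par p \<noteq> q"
    using m_pos by (auto simp: par_leg depth_def)
  then show "\<not> parent_adj par p q" by (auto simp: parent_adj_def)
qed (use par_less leg_end m_pos in auto)

sublocale parent_tree_edge par n p q
  by (rule parent_tree_edge)

lemma chord_not_leg: "\<not> leg u \<Longrightarrow> chord u = 0"
  using m_pos unfolding chord_def leg_def by auto

text \<open>These degrees are the source of the diagonal entries 0 and -1 of L(T) - 2 along the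
  legs.\<close>

lemma leg_degree:
  assumes "leg u"
  shows "(\<Sum>v<n. tree_adj par u v) = (if u = p \<or> u = q then 1 else 2)"
proof -
  have "0 < u" "u < n" using assms leg_end by (auto simp: leg_def)
  moreover have "leg (u + 2) \<longleftrightarrow> \<not> (u = p \<or> u = q)"
    using assms m_pos by (auto simp: leg_def)
  ultimately show ?thesis
    using sum_tree_adj[OF par_less, of u n "\<lambda>_. 1"] children_leg[OF assms, of "\<lambda>_. 1"]
    by simp
qed

section \<open>Independence of the energy from the chosen pair of legs\<close>

lemma sum_reindex_mirror: "(\<Sum>v<n. h (mirror v)) = (\<Sum>v<n. h v)"
  by (rule sum.reindex_bij_witness[of _ mirror mirror]) (auto simp: mirror_less)

lemma sum_reindex_cotwist: "(\<Sum>v<n. h (cotwist v)) = (\<Sum>v<n. h v)"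
  by (rule sum.reindex_bij_witness[of _ cotwist cotwist]) (auto simp: cotwist_less)

text \<open>The tree Laplacian is shifted by 2, the average degree of the graph with the extra
  edge.\<close>

definition M :: "nat \<Rightarrow> nat \<Rightarrow> real" where
  "M u v = tree_lap par n u v - (if u = v then 2 else 0)"

lemma degree_mirror: "(\<Sum>w<n. tree_adj par (mirror u) w) = (\<Sum>w<n. tree_adj par u w)"
  using sum_reindex_mirror[of "tree_adj par (mirror u)"] by (simp add: tree_adj_mirror)

lemma degree_twist: "(\<Sum>w<n. tree_adj par (twist u) w) = (\<Sum>w<n. tree_adj par u w)"
  by (simp add: twist_def degree_mirror)

lemma M_mirror: "M (mirror u) (mirror v) = M u v"
  by (simp add: M_def tree_lap_def degree_mirror tree_adj_mirror)

lemma mirror_ends: "mirror p = q" "mirror q = p"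
proof -
  have "leg p" "odd p" using m_pos even_s by (auto simp: leg_def)
  then show "mirror p = q" using m_pos by (simp add: mirror_def)
  then show "mirror q = p" by (metis mirror_mirror)
qed

text \<open>
  Permuting the columns moves the diagonal entries of \<^const>\<open>M\<close> on the legs off the diagonal. They are 0 at
  the inner vertices and $-1$ at the two ends, so they become exactly the new edge.
\<close>

lemma M_twist:
  "M (twist u) (cotwist v) = tree_lap par n u v + chord u * chord v - (if u = v then 2 else 0)"
proof -
  define d where "d = (\<Sum>w<n. tree_adj par u w) - 2"
  have "twist u = cotwist v \<longleftrightarrow> u = mirror v"
    by (simp flip: twist_mirror)
  then have "M (twist u) (cotwist v) = (if u = mirror v then d else 0) - tree_adj par u v"
    by (auto simp: M_def tree_lap_def tree_adj_twist d_def degree_twist)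
  moreover have "(if u = mirror v then d else 0) = (if u = v then d else 0) + chord u * chord v"
  proof (cases "leg u")
    case False
    then have "u = mirror v \<longleftrightarrow> u = v"
      using leg_mirror[of v] mirror_def[of v] by (cases "leg v") auto
    moreover have "chord u = 0"
      using False by (rule chord_not_leg)
    ultimately show ?thesis by simp
  next
    case True
    show ?thesis
    proof (cases "u = p \<or> u = q")
      case True
      \<comment> \<open>In row \<open>p\<close> the entry -1 moves to column \<open>q\<close>,
        matching \<open>chord p * chord q\<close>; on the diagonal, \<open>d\<close> and the square
        of \<open>chord p\<close> cancel. Row \<open>q\<close> is symmetric.\<close>
      have "d = -1" using leg_degree[OF \<open>leg u\<close>] True by (simp add: d_def)
      moreover have "u = mirror v \<longleftrightarrow> mirror u = v" by auto
      ultimately show ?thesis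
        using True mirror_ends p_neq_q unfolding chord_def by auto
    next
      case False
      then have "d = 0" using leg_degree[OF \<open>leg u\<close>] by (simp add: d_def)
      then show ?thesis using False unfolding chord_def by simp
    qed
  qed
  ultimately show ?thesis by (simp add: tree_lap_def d_def)
qed

text \<open>The right-hand side contains only the tree, neither \<open>s\<close> nor
  \<open>m\<close>, so every pair of legs of one tree gives the same energy.\<close>

lemma laplacian_energy_parent_tree_plus:
  "laplacian_energy G =
    (\<Sum>\<nu>\<in>#proots (char_poly (mat n n (\<lambda>(i, j). \<Sum>l<n.
       (tree_lap par n i l - (if i = l then 2 else 0)) * (tree_lap par n l j - (if l = j then 2 else 0))))). sqrt \<nu>)"
proof -
  define B where "B = laplacian_matrix G - 2 \<cdot>\<^sub>m 1\<^sub>m n"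
  have B: "B = mat n n (\<lambda>(i, j). M (twist i) (cotwist j))"
    unfolding B_def laplacian_parent_tree_plus
    by (rule eq_matI) (auto simp: M_twist)
  define Q where "Q i j = (\<Sum>l<n. M i l * M l j)" for i j
  have "(\<Sum>l<n. M (twist i) (cotwist l) * M (twist l) (cotwist j)) = Q (twist i) (twist j)" for i j
  proof -
    \<comment> \<open>Mirroring both arguments is the commutation of M with P. It lets the two
      factors P meet and cancel, so that only M^2 remains after reindexing.\<close>
    have "M (twist l) (cotwist j) = M (cotwist l) (twist j)" for l
      using M_mirror[of "twist l" "cotwist j"] by (simp add: mirror_twist mirror_cotwist)
    then show ?thesis
      unfolding Q_def using sum_reindex_cotwist[of "\<lambda>l. M (twist i) l * M l (twist j)"] by simp
  qed
  then have BB: "B * B = mat n n (\<lambda>(i, j). Q (twist i) (twist j))"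
    unfolding B index_mult_mat_mat by simp
  have "laplacian_energy G = (\<Sum>\<nu>\<in>#proots (char_poly (B * B)). sqrt \<nu>)"
    unfolding laplacian_energy_def laplacian_spectrum_def average_degree_parent_tree_plus B_def
    by (rule sum_abs_eigenvalue_deviation[OF laplacian_carrier laplacian_sym])
  also have "char_poly (B * B) = char_poly (mat n n (\<lambda>(i, j). Q i j))"
    unfolding BB by (rule char_poly_permute) (auto simp: twist_less)
  finally show ?thesis unfolding Q_def M_def .
qed

text \<open>The electrical potential of a unit current from \<^term>\<open>p\<close> to \<^term>\<open>q\<close>.\<close>

definition potential :: "nat \<Rightarrow> real" where
  "potential v = (if leg v then (if odd v then 1 else -1) * (real (depth v) + 1) else 0)"

lemma potential_mirror: "potential (mirror v) = - potential v"
proof -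
  have "leg v \<Longrightarrow> odd (mirror v) \<longleftrightarrow> even v" by (auto simp: mirror_def leg_def)
  then show ?thesis by (simp add: potential_def)
qed

text \<open>Every leg edge carries unit current, towards 0 on the odd leg and away from it on the
  even one.\<close>

lemma potential_parent: "leg v \<Longrightarrow> potential v - potential (par v) = (if odd v then 1 else -1)"
  using leg_parent[of v]
  by (cases "depth v = 0") (auto simp: par_leg potential_def leg_def depth_def)

text \<open>Kirchhoff's law: on the legs the currents balance except at the ends, and elsewhere the
  contributions cancel by antisymmetry under \<open>mirror\<close>. Antisymmetry also makes the
  all-ones part vanish.\<close>

lemma potential_eq:
  assumes "u < n"
  shows "(\<Sum>v<n. (tree_lap par n u v + 1) * potential v) = chord u"
proof -
  have anti: "(\<Sum>v<n. h v) = 0" if "\<And>v. h (mirror v) = - h v" for h :: "nat \<Rightarrow> real"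
    using sum_reindex_mirror[of h] that by (simp add: sum_negf)
  have "(\<Sum>v<n. (tree_lap par n u v + 1) * potential v) =
      (\<Sum>v<n. tree_lap par n u v * potential v) + (\<Sum>v<n. potential v)"
    by (simp add: algebra_simps sum.distrib)
  also have "(\<Sum>v<n. potential v) = 0" by (rule anti) (rule potential_mirror)
  also have "(\<Sum>v<n. tree_lap par n u v * potential v) =
      of_bool (0 < u) * (potential u - potential (par u)) +
      (\<Sum>v<n. of_bool (0 < v \<and> par v = u) * (potential u - potential v))"
    using sum_tree_lap[OF assms] sum_tree_adj[OF par_less assms] by simp
  also have "\<dots> = chord u"
  proof (cases "leg u")
    case True
    have "0 < u" using True by (simp add: leg_def)
    have "leg (u + 2) \<Longrightarrow> par (u + 2) = u"
      using par_leg[of "u + 2"] True by (auto simp: leg_def depth_def)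
    then have "leg (u + 2) \<Longrightarrow> potential u - potential (u + 2) = (if odd u then -1 else 1)"
      using potential_parent[of "u + 2"] by (auto split: if_splits)
    moreover have "leg (u + 2) \<longleftrightarrow> \<not> (u = p \<or> u = q)"
      using True m_pos by (auto simp: leg_def)
    moreover have "odd p" "even q" using m_pos even_s by auto
    ultimately show ?thesis
      using potential_parent[OF True] children_leg[OF True] \<open>0 < u\<close> p_neq_q
      unfolding chord_def by auto
  next
    case False
    then have [simp]: "potential u = 0" by (simp add: potential_def)
    have "chord u = 0" using False by (rule chord_not_leg)
    moreover have "0 < u \<Longrightarrow> potential (par u) = 0"
      using par_not_leg[OF _ False] by (simp add: potential_def)
    \<comment> \<open>As \<open>mirror\<close> fixes \<open>u\<close>, it permutes the children of
      \<open>u\<close> and negates their potentials. At vertex 0 this cancels the currents of the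
      two legs.\<close>
    moreover have "(\<Sum>v<n. of_bool (0 < v \<and> par v = u) * (potential u - potential v)) = 0"
    proof (rule anti)
      fix v
      have "mirror u = u" using False by (simp add: mirror_def)
      then have "0 < mirror v \<and> par (mirror v) = u \<longleftrightarrow> 0 < v \<and> par v = u"
        using mirror_pos par_mirror mirror_mirror by metis
      then show "of_bool (0 < mirror v \<and> par (mirror v) = u) * (potential u - potential (mirror v)) =
          - (of_bool (0 < v \<and> par v = u) * (potential u - potential v))"
        by (simp add: potential_mirror)
    qed
    ultimately show ?thesis by (cases "u = 0") simp_all
  qed
  finally show ?thesis by simp
qed

lemma det_leg_pair:
  "det (laplacian_matrix G + mat n n (\<lambda>_. 1)) =
    det (mat n n (\<lambda>(i, j). tree_lap par n i j + 1)) * (1 + 2 * real m)"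
proof -
  have "leg p" "leg q" "odd p" "even q" using m_pos even_s by (auto simp: leg_def)
  moreover have "depth p = m - 1" "depth q = m - 1" using m_pos by (auto simp: depth_def)
  ultimately have "potential p = real m" "potential q = - real m"
    using m_pos by (auto simp: potential_def of_nat_diff)
  then show ?thesis
    using det_laplacian_plus_ones[OF potential_eq] by simp
qed

end

text \<open>Equal spectra would give equal determinants of L + J. The common factor from the tree is
  nonzero, so the factors \<open>1 + 2 * m\<close> and \<open>1 + 2 * m'\<close> would
  agree.\<close>

lemma leg_pairs_not_cospectral:
  assumes 1: "leg_pair par n s m" and 2: "leg_pair par n s' m'" and "m \<noteq> m'"
  shows "\<not> cospectral (parent_tree_plus par n (s + 2 * m - 1) (s + 2 * m))
    (parent_tree_plus par n (s' + 2 * m' - 1) (s' + 2 * m'))"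
proof
  interpret A: leg_pair par n s m by fact
  interpret B: leg_pair par n s' m' by fact
  assume "cospectral A.G B.G"
  moreover have "char_poly (laplacian_matrix A.G) = (\<Prod>a\<in>#laplacian_spectrum A.G. [:- a, 1:])"
    unfolding laplacian_spectrum_def
    by (rule char_poly_symmetric_eq_prod[OF A.laplacian_carrier A.laplacian_sym])
  moreover have "char_poly (laplacian_matrix B.G) = (\<Prod>a\<in>#laplacian_spectrum B.G. [:- a, 1:])"
    unfolding laplacian_spectrum_def
    by (rule char_poly_symmetric_eq_prod[OF B.laplacian_carrier B.laplacian_sym])
  ultimately have "char_poly (laplacian_matrix A.G) = char_poly (laplacian_matrix B.G)"
    by (simp only: cospectral_def)
  then have "det (laplacian_matrix A.G + mat n n (\<lambda>_. 1)) = det (laplacian_matrix B.G + mat n n (\<lambda>_. 1))"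
    by (intro det_add_const_eq_if_char_poly_eq[OF A.laplacian_carrier B.laplacian_carrier _
          A.laplacian_mult_ones B.laplacian_mult_ones]) auto
  then show False
    using A.det_leg_pair B.det_leg_pair det_tree_lap_plus_ones_nonzero[of par n, OF A.par_less] \<open>m \<noteq> m'\<close>
    by simp
qed

section \<open>Spiders\<close>

text \<open>
  The vertices $k(k+1)+1, \dots, (k+1)(k+2)$ carry two legs of length $k+1$. If \<^term>\<open>n\<close> cuts the last
  block short, its legs are truncated, which does no harm.
\<close>

definition spider_parent :: "nat \<Rightarrow> nat" where
  "spider_parent v = (if \<exists>k. v = k * (k + 1) + 1 \<or> v = k * (k + 1) + 2 then 0 else v - 2)"

lemma leg_pair_spider:
  assumes "(k + 1) * (k + 2) < n"
  shows "leg_pair spider_parent n (k * (k + 1)) (k + 1)"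
proof
  \<comment> \<open>Block \<open>j\<close> ends at \<open>(j + 1) * (j + 2)\<close>, just before
    block \<open>j + 1\<close>. The blocks are thus disjoint, and no other leg starts inside block
    \<open>k\<close>.\<close>
  have step: "j * (j + 1) + 2 * (j + 1) \<le> k * (k + 1)" if "j < k" for j k :: nat
    using mult_le_mono[of "j + 1" k "j + 2" "k + 1"] that by (simp add: algebra_simps)
  show "spider_parent v < v" if "0 < v" for v
    using that by (auto simp: spider_parent_def)
  show "spider_parent v = v - 2" if "k * (k + 1) + 2 < v" "v \<le> k * (k + 1) + 2 * (k + 1)" for v
  proof -
    have "v \<noteq> j * (j + 1) + 1 \<and> v \<noteq> j * (j + 1) + 2" for j
      using that step[of j k] step[of k j] by (cases j k rule: linorder_cases) auto
    then show ?thesis by (simp add: spider_parent_def)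
  qed
  show "\<not> (k * (k + 1) < spider_parent v \<and> spider_parent v \<le> k * (k + 1) + 2 * (k + 1))"
    if "\<not> (k * (k + 1) < v \<and> v \<le> k * (k + 1) + 2 * (k + 1))" for v
  \<comment> \<open>Only these two labels outside block \<open>k\<close> have \<open>v - 2\<close>
    inside it; they start the next block, so their parent is 0.\<close>
  proof (cases "v = (k + 1) * (k + 2) + 1 \<or> v = (k + 1) * (k + 2) + 2")
    case True
    then have "\<exists>j. v = j * (j + 1) + 1 \<or> v = j * (j + 1) + 2"
      by (intro exI[of _ "k + 1"]) simp
    then have "spider_parent v = 0" by (simp only: spider_parent_def if_True)
    then show ?thesis by simp
  next
    case False
    then show ?thesis using that by (auto simp: spider_parent_def algebra_simps)
  qed
qed (use assms in \<open>auto simp: spider_parent_def algebra_simps\<close>)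

definition spider_plus :: "nat \<Rightarrow> nat \<Rightarrow> nat pair_pre_digraph" where
  "spider_plus n k = parent_tree_plus spider_parent n ((k + 1) * (k + 2) - 1) ((k + 1) * (k + 2))"

lemma spider_plus_eq:
  "spider_plus n k = parent_tree_plus spider_parent n
     (k * (k + 1) + 2 * (k + 1) - 1) (k * (k + 1) + 2 * (k + 1))"
proof -
  have "(k + 1) * (k + 2) = k * (k + 1) + 2 * (k + 1)" by simp
  then show ?thesis by (simp only: spider_plus_def)
qed

text \<open>The first \<open>l\<close> blocks end at label \<open>l * (l + 1)\<close>, so they all
  fit into the same spider on \<open>n\<close> vertices; each graph closes one of these
  blocks.\<close>

lemma noncospectral_equienergetic_spiders:
  assumes "l * (l + 1) < n"
  shows "\<exists>\<F>. card \<F> = l \<and> noncospectral_equienergetic_family n \<F>"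
proof -
  let ?F = "spider_plus n ` {..<l}"
  have leg: "leg_pair spider_parent n (k * (k + 1)) (k + 1)" if "k < l" for k
  proof (rule leg_pair_spider)
    have "(k + 1) * (k + 2) \<le> l * (l + 1)" using that by (intro mult_le_mono) auto
    then show "(k + 1) * (k + 2) < n" using assms by simp
  qed
  have edge: "parent_tree_edge spider_parent n (k * (k + 1) + 2 * (k + 1) - 1) (k * (k + 1) + 2 * (k + 1))"
    if "k < l" for k
    using leg_pair.parent_tree_edge[OF leg[OF that]] .
  have non: "\<not> cospectral (spider_plus n j) (spider_plus n k)" if "j < l" "k < l" "j \<noteq> k" for j k
    unfolding spider_plus_eq using leg_pairs_not_cospectral[OF leg[OF that(1)] leg[OF that(2)]] that by simp
  have "inj_on (spider_plus n) {..<l}"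
    \<comment> \<open>Every graph is cospectral with itself, so equal graphs have equal
      indices.\<close>
    by (rule inj_onI) (metis non cospectral_def lessThan_iff)
  then have "card ?F = l" by (simp add: card_image)
  moreover have "noncospectral_equienergetic_family n ?F"
    unfolding noncospectral_equienergetic_family_def
  proof (intro conjI ballI impI)
    fix A assume "A \<in> ?F"
    then obtain j where j: "j < l" "A = spider_plus n j" by auto
    show "graph_on n A" "unicyclic A"
      unfolding j(2) spider_plus_eq
      using parent_tree_edge.graph_on_parent_tree_plus[OF edge[OF j(1)]]
        parent_tree_edge.unicyclic_parent_tree_plus[OF edge[OF j(1)]] .
    fix B assume "B \<in> ?F"
    then obtain k where k: "k < l" "B = spider_plus n k" by auto
    show "laplacian_energy A = laplacian_energy B"
      unfolding j(2) k(2) spider_plus_eq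
      using leg_pair.laplacian_energy_parent_tree_plus[OF leg[OF j(1)]]
        leg_pair.laplacian_energy_parent_tree_plus[OF leg[OF k(1)]] by simp
    show "\<not> cospectral A B" if "A \<noteq> B"
      using that non j k by auto
  qed simp
  ultimately show ?thesis by blast
qed

theorem theorem1p3:
  shows "(\<forall>l::nat. l \<ge> 2 \<longrightarrow>
            (\<exists>\<F>. card \<F> = l \<and> noncospectral_equienergetic_family (2 * l^2 + 2 * l + 2) \<F>))
       \<and> (\<exists>s :: nat \<Rightarrow> nat.
            (\<lambda>n. real (s n)) \<in>
              \<Theta>[inf at_top (principal {2 * l^2 + 2 * l + 2 | l::nat. l \<ge> 2})](\<lambda>n. sqrt (real n)) \<and>
            (\<forall>n \<in> {2 * l^2 + 2 * l + 2 | l::nat. l \<ge> 2}.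
               \<exists>\<F>. card \<F> = s n \<and> noncospectral_equienergetic_family n \<F>))"
proof -
  let ?N = "\<lambda>l::nat. 2 * l^2 + 2 * l + 2"
  have main: "\<exists>\<F>. card \<F> = l \<and> noncospectral_equienergetic_family (?N l) \<F>" for l
    by (rule noncospectral_equienergetic_spiders) (simp add: power2_eq_square algebra_simps)
  \<comment> \<open>This recovers \<open>l\<close> from \<open>n\<close>. Elsewhere the value is
    unspecified, and the filter restricts the asymptotic claim to \<open>n\<close> of the given
    form.\<close>
  define s where "s n = (SOME l. l \<ge> 2 \<and> n = ?N l)" for n
  have s: "s n \<ge> 2 \<and> n = ?N (s n)" if "n \<in> {?N l | l. l \<ge> 2}" for n
  proof -
    have "\<exists>l. l \<ge> 2 \<and> n = ?N l" using that by blast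
    from someI_ex[OF this] show ?thesis by (simp only: s_def)
  qed
  have lower: "real (s n) \<le> sqrt (real n)" if "n \<in> {?N l | l. l \<ge> 2}" for n
  proof (rule real_le_rsqrt)
    have "(s n)\<^sup>2 \<le> n" using s[OF that] by linarith
    then show "(real (s n))\<^sup>2 \<le> real n" by (metis of_nat_le_iff of_nat_power)
  qed
  have upper: "sqrt (real n) \<le> 3 * real (s n)" if "n \<in> {?N l | l. l \<ge> 2}" for n
  proof (rule real_le_lsqrt)
    \<comment> \<open>For \<open>l \<ge> 2\<close> both \<open>2 * l\<close> and 2 are at most
      \<open>l\<^sup>2\<close>, so the left side is at most \<open>4 * l\<^sup>2\<close>; the
      constant 3 leaves room.\<close>
    have "?N l \<le> (3 * l)\<^sup>2" if "l \<ge> 2" for l :: nat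
    proof -
      have "2 * l \<le> l\<^sup>2" using that by (simp add: power2_eq_square)
      moreover have "(3 * l)\<^sup>2 = 9 * l\<^sup>2" by (simp add: power2_eq_square)
      ultimately show ?thesis using that by linarith
    qed
    then have "?N (s n) \<le> (3 * s n)\<^sup>2" using s[OF that] by blast
    then have "n \<le> (3 * s n)\<^sup>2" using s[OF that] by linarith
    then show "real n \<le> (3 * real (s n))\<^sup>2" by (metis of_nat_le_iff of_nat_power of_nat_mult of_nat_numeral)
  qed simp
  have "(\<lambda>n. real (s n)) \<in> \<Theta>[inf at_top (principal {?N l | l. l \<ge> 2})](\<lambda>n. sqrt (real n))"
  proof (rule bigthetaI')
    show "eventually (\<lambda>n. norm (real (s n)) \<ge> (1/3) * norm (sqrt (real n)) \<and>
        norm (real (s n)) \<le> 1 * norm (sqrt (real n))) (inf at_top (principal {?N l | l. l \<ge> 2}))"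
      unfolding eventually_inf_principal
      using lower upper by (intro always_eventually allI impI) (force simp: field_simps)
  qed simp_all
  moreover have "\<forall>n \<in> {?N l | l. l \<ge> 2}. \<exists>\<F>. card \<F> = s n \<and> noncospectral_equienergetic_family n \<F>"
  proof
    fix n assume "n \<in> {?N l | l. l \<ge> 2}"
    then have "?N (s n) = n" using s by simp
    then show "\<exists>\<F>. card \<F> = s n \<and> noncospectral_equienergetic_family n \<F>"
      using main[of "s n"] by simp
  qed
  ultimately show ?thesis using main by blast
qed

end
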